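(* For every $t\in\mathbb{N}$ there exist a graph $G_t$ and a circular drawing $D$ of $G_t$ such that $G_t$ contains a $K_t$-minor, $G_t$ has maximum degree $3$, and the crossing graph $X_D$ is $2$-degenerate.
   Context: A circular drawing of a graph $G$ places the vertices at distinct points on a circle and draws each edge as the straight line segment between its endpoints. Two edges cross if their segments intersect at a point that is not an endpoint of either. The crossing graph $X_D$ has vertex set $E(G)$, two edges adjacent iff they cross in $D$. A graph is $2$-degenerate if every nonempty subgraph has a vertex of degree at most $2$. *)

theory Defs
  imports "HOL-Analysis.Analysis"
begin

datatype 'a ugraph = Graph (verts: "'a set") (edges: "'a set set")

definition simple_graph :: "'a ugraph \<Rightarrow> bool" where
  "simple_graph G \<longleftrightarrow> finite (verts G) \<and> (\<forall>e \<in> edges G. e \<subseteq> verts G \<and> card e = 2)"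

definition subgraph :: "'a ugraph \<Rightarrow> 'a ugraph \<Rightarrow> bool" where
  "subgraph H G \<longleftrightarrow> simple_graph H \<and> verts H \<subseteq> verts G \<and> edges H \<subseteq> edges G"

definition graph_iso :: "'a ugraph \<Rightarrow> 'b ugraph \<Rightarrow> bool" where
  "graph_iso G H \<longleftrightarrow> (\<exists>f. bij_betw f (verts G) (verts H) \<and> edges H = (\<lambda>e. f ` e) ` edges G)"

definition complete_graph :: "nat \<Rightarrow> nat ugraph" where
  "complete_graph t = Graph {..<t} {e. e \<subseteq> {..<t} \<and> card e = 2}"

definition vertex_degree :: "'a ugraph \<Rightarrow> 'a \<Rightarrow> nat" where
  "vertex_degree G v = card {e \<in> edges G. v \<in> e}"

text \<open>The \<open>insert 0\<close> only matters for the graph without vertices.\<close>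

definition max_degree :: "'a ugraph \<Rightarrow> nat" where
  "max_degree G = Max (insert 0 (vertex_degree G ` verts G))"

definition degenerate :: "nat \<Rightarrow> 'a ugraph \<Rightarrow> bool" where
  "degenerate d G \<longleftrightarrow>
     (\<forall>H. subgraph H G \<and> verts H \<noteq> {} \<longrightarrow> (\<exists>v \<in> verts H. vertex_degree H v \<le> d))"

text \<open>Contracting the edge \<open>{u, v}\<close> merges \<open>v\<close> into \<open>u\<close>; the loop \<open>{u}\<close> is discarded, and
  parallel edges coincide because edges form a set.\<close>

definition contract_edge :: "'a \<Rightarrow> 'a \<Rightarrow> 'a ugraph \<Rightarrow> 'a ugraph" where
  "contract_edge u v G =
     Graph (verts G - {v}) ((\<lambda>e. (\<lambda>w. if w = v then u else w) ` e) ` edges G - {{u}})"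

inductive contracts_to :: "'a ugraph \<Rightarrow> 'a ugraph \<Rightarrow> bool" for G where
  refl: "contracts_to G G"
| step: "contracts_to G (contract_edge u v H)"
    if "contracts_to G H" "{u, v} \<in> edges H" "u \<noteq> v"

definition is_minor :: "'a ugraph \<Rightarrow> 'b ugraph \<Rightarrow> bool" where
  "is_minor H G \<longleftrightarrow> (\<exists>S K. subgraph S G \<and> contracts_to S K \<and> graph_iso H K)"

text \<open>A circular drawing is given by the positions of the vertices in the plane; the edges are then
  determined as straight line segments.\<close>

definition circular_drawing :: "'a ugraph \<Rightarrow> ('a \<Rightarrow> complex) \<Rightarrow> bool" where
  "circular_drawing G D \<longleftrightarrow>
     inj_on D (verts G) \<and> (\<exists>c r. r > 0 \<and> D ` verts G \<subseteq> sphere c r)"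

definition edges_cross :: "('a \<Rightarrow> complex) \<Rightarrow> 'a set \<Rightarrow> 'a set \<Rightarrow> bool" where
  "edges_cross D e f \<longleftrightarrow> e \<noteq> f \<and>
     (\<exists>u v x y z. e = {u, v} \<and> f = {x, y} \<and>
        z \<in> closed_segment (D u) (D v) \<and> z \<in> closed_segment (D x) (D y) \<and>
        z \<notin> {D u, D v, D x, D y})"

definition crossing_graph :: "'a ugraph \<Rightarrow> ('a \<Rightarrow> complex) \<Rightarrow> 'a set ugraph" where
  "crossing_graph G D =
     Graph (edges G) {{e, f} | e f. e \<in> edges G \<and> f \<in> edges G \<and> edges_cross D e f}"

end

theory Submission
  imports Defs
begin

text \<open>Place the natural numbers in their usual order on a circle and join each \<open>n\<close> with
  \<open>2\<close>-adic valuation \<open>k\<close> to \<open>n \<plusminus> 2\<^bsup>k + 1\<^esup>\<close>. Strictly between the ends of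
  such an edge the only vertex of valuation at least \<open>k\<close> is the midpoint, which has just two such
  edges. Hence an edge of smallest valuation in a set of edges crosses at most two others of the set,
  while an edge \<open>{n, n + 1}\<close> crosses nothing.

  The vertices of valuation \<open>k + 2\<close> form a path, the \<open>k\<close>-th spine. For \<open>i < j\<close> a private
  interval of the circle is reserved in which two edges \<open>{b, b + 1}\<close> and \<open>{a - 1, a}\<close> link spines
  \<open>j\<close> and \<open>i\<close> along the path \<open>b, b + 1, b + 3, \<dots>, a - 1, a\<close> through odd numbers. No vertex lies on
  two of these additional edges, so the degrees are at most \<open>3\<close>, and the spines together with the
  interiors of the links are branch sets of a complete minor.\<close>

subsection \<open>Branch sets of minors\<close>

definition adjacency_on :: "'a ugraph \<Rightarrow> 'a set \<Rightarrow> 'a rel" where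
  "adjacency_on G A = {(x, y). x \<in> A \<and> y \<in> A \<and> {x, y} \<in> edges G}"

definition induces_connected :: "'a ugraph \<Rightarrow> 'a set \<Rightarrow> bool" where
  "induces_connected G A \<longleftrightarrow> (\<forall>u\<in>A. \<forall>v\<in>A. (u, v) \<in> (adjacency_on G A)\<^sup>*)"

lemma induces_connected_mono:
  assumes "induces_connected G A" "{e \<in> edges G. e \<subseteq> A} \<subseteq> edges H"
  shows "induces_connected H A"
proof -
  have "adjacency_on G A \<subseteq> adjacency_on H A"
    using assms(2) by (auto simp: adjacency_on_def)
  from rtrancl_mono[OF this] assms(1) show ?thesis
    unfolding induces_connected_def by blast
qed

lemma induces_connected_wellorderI:
  fixes A :: "'a::wellorder set"
  assumes "r \<in> A" and descent: "\<And>n. n \<in> A \<Longrightarrow> n \<noteq> r \<Longrightarrow> \<exists>m\<in>A. m < n \<and> {m, n} \<in> edges G"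
  shows "induces_connected G A"
proof -
  have from_root: "(r, n) \<in> (adjacency_on G A)\<^sup>*" if "n \<in> A" for n
    using that
  proof (induction n rule: less_induct)
    case (less n)
    show ?case
    proof (cases "n = r")
      case False
      with descent less.prems obtain m where "m \<in> A" "m < n" "(m, n) \<in> adjacency_on G A"
        unfolding adjacency_on_def by blast
      with less.IH show ?thesis by (blast intro: rtrancl_into_rtrancl)
    qed simp
  qed
  have "sym ((adjacency_on G A)\<^sup>*)"
    by (intro sym_rtrancl) (auto simp: sym_def adjacency_on_def insert_commute)
  with from_root have "(u, v) \<in> (adjacency_on G A)\<^sup>*" if "u \<in> A" "v \<in> A" for u v
    using that by (meson rtrancl_trans symD)
  then show ?thesis unfolding induces_connected_def by blast
qed

definition quotient_graph :: "('a \<Rightarrow> 'b) \<Rightarrow> 'a ugraph \<Rightarrow> 'b ugraph" where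
  "quotient_graph f G = Graph (f ` verts G) {d \<in> (`) f ` edges G. card d = 2}"

lemma verts_quotient_graph: "verts (quotient_graph f G) = f ` verts G"
  by (simp add: quotient_graph_def)

lemma quotient_graph_edge:
  assumes "{x, y} \<in> edges G" "f x \<noteq> f y"
  shows "{f x, f y} \<in> edges (quotient_graph f G)"
  using imageI[OF assms(1), of "(`) f"] assms(2) by (simp add: quotient_graph_def)

lemma simple_quotient_graph: "simple_graph G \<Longrightarrow> simple_graph (quotient_graph f G)"
  by (auto simp: simple_graph_def quotient_graph_def)

lemma quotient_graph_eqI:
  assumes "simple_graph H" "f ` verts G = verts H"
    and "\<And>e. e \<in> edges G \<Longrightarrow> card (f ` e) = 2 \<Longrightarrow> f ` e \<in> edges H"
    and lift: "\<And>x y. {x, y} \<in> edges H \<Longrightarrow> \<exists>u v. {u, v} \<in> edges G \<and> f u = x \<and> f v = y"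
  shows "quotient_graph f G = H"
proof -
  have "edges (quotient_graph f G) = edges H"
  proof (intro equalityI subsetI)
    fix d assume "d \<in> edges H"
    then obtain x y where d: "d = {x, y}" "x \<noteq> y"
      using assms(1) by (auto simp: simple_graph_def card_2_iff)
    with lift \<open>d \<in> edges H\<close> obtain u v where "{u, v} \<in> edges G" "f u = x" "f v = y"
      by blast
    with d show "d \<in> edges (quotient_graph f G)"
      using quotient_graph_edge[of u v G f] by simp
  qed (auto simp: quotient_graph_def assms(3))
  then show ?thesis
    by (simp add: ugraph.expand verts_quotient_graph assms(2))
qed

lemma quotient_quotient_graph:
  assumes "simple_graph G" "\<And>v. f (g v) = f v"
  shows "quotient_graph f (quotient_graph g G) = quotient_graph f G"
proof -
  have image: "f ` g ` A = f ` A" for A by (simp add: image_image assms(2))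
  have card_g: "card (g ` e) = 2" if "e \<in> edges G" "card (f ` e) = 2" for e
  proof -
    have "finite e" "card e = 2"
      using assms(1) that(1) by (auto simp: simple_graph_def card_2_iff)
    then have "card (g ` e) \<le> 2" "card (f ` g ` e) \<le> card (g ` e)"
      using card_image_le[of e g] by (simp_all add: card_image_le)
    with that(2) show ?thesis by (simp add: image)
  qed
  have "(`) f ` {d \<in> (`) g ` edges G. card d = 2} \<inter> {d. card d = 2} =
      (`) f ` edges G \<inter> {d. card d = 2}" (is "?L = ?R")
  proof (intro equalityI subsetI)
    fix d assume "d \<in> ?R"
    then obtain e where e: "e \<in> edges G" "card (f ` e) = 2" "d = f ` g ` e"
      by (auto simp: image)
    with card_g have "g ` e \<in> {d \<in> (`) g ` edges G. card d = 2}"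
      by simp
    then have "f ` g ` e \<in> (`) f ` {d \<in> (`) g ` edges G. card d = 2}"
      by (rule imageI)
    with e show "d \<in> ?L" by (simp add: image)
  qed (auto simp: image)
  then show ?thesis
    by (simp add: quotient_graph_def image Int_def)
qed

lemma induces_connected_quotient_graph:
  assumes "induces_connected G A"
  shows "induces_connected (quotient_graph f G) (f ` A)"
proof -
  let ?Q = "adjacency_on (quotient_graph f G) (f ` A)"
  have "(f u, f v) \<in> ?Q\<^sup>*" if "(u, v) \<in> (adjacency_on G A)\<^sup>*" for u v
    using that
  proof induction
    case (step y z)
    have "f y = f z \<or> (f y, f z) \<in> ?Q"
      using step.hyps(2) by (auto simp: adjacency_on_def intro: quotient_graph_edge)
    with step.IH show ?case
      by (elim disjE) (simp, rule rtrancl_into_rtrancl)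
  qed simp
  with assms show ?thesis
    by (simp add: induces_connected_def)
qed

lemma contract_edge_eq_quotient_graph:
  assumes "simple_graph G" "{u, v} \<in> edges G"
  shows "contract_edge u v G = quotient_graph (id(v := u)) G"
proof -
  define g where "g = id(v := u)"
  have g: "g = (\<lambda>w. if w = v then u else w)"
    by (auto simp: g_def)
  have "u \<in> verts G" "u \<noteq> v"
    using assms by (auto simp: simple_graph_def)
  then have "g ` verts G = verts G - {v}"
    by (auto simp: g)
  moreover have "g ` e \<noteq> {u} \<longleftrightarrow> card (g ` e) = 2" if "e \<in> edges G" for e
  proof -
    have "card e = 2"
      using assms(1) that by (simp add: simple_graph_def)
    then obtain x y where "e = {x, y}" "x \<noteq> y"
      unfolding card_2_iff by blast
    then show ?thesis
      by (cases "x = v"; cases "y = v") (auto simp: g card_insert_if)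
  qed
  then have "(`) g ` edges G - {{u}} = {d \<in> (`) g ` edges G. card d = 2}"
    by auto
  ultimately show ?thesis
    unfolding contract_edge_def quotient_graph_def g_def[symmetric] g[symmetric] by simp
qed

lemma graph_iso_quotient_graph:
  assumes "simple_graph G" "inj_on f (verts G)"
  shows "graph_iso (quotient_graph f G) G"
proof -
  let ?g = "inv_into (verts G) f"
  have edge: "e \<subseteq> verts G" "card (f ` e) = 2" if "e \<in> edges G" for e
    using assms that by (auto simp: simple_graph_def card_image inj_on_subset)
  then have "(\<lambda>e. ?g ` f ` e) ` edges G = (\<lambda>e. e) ` edges G"
    using assms(2) by (intro image_cong) simp_all
  moreover have "edges (quotient_graph f G) = (`) f ` edges G"
    using edge by (auto simp: quotient_graph_def)
  moreover have "bij_betw ?g (verts (quotient_graph f G)) (verts G)"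
    using assms(2) by (simp add: verts_quotient_graph bij_betw_inv_into inj_on_imp_bij_betw)
  ultimately show ?thesis
    unfolding graph_iso_def by (intro exI[of _ ?g]) (simp add: image_image)
qed

lemma contracts_to_trans: "contracts_to H K \<Longrightarrow> contracts_to G H \<Longrightarrow> contracts_to G K"
  by (induction rule: contracts_to.induct) (auto intro: contracts_to.step)

lemma quotient_graph_contract_edge:
  assumes "simple_graph G" "{u, v} \<in> edges G" "f u = f v"
  shows "quotient_graph f (contract_edge u v G) = quotient_graph f G"
  using assms by (simp add: contract_edge_eq_quotient_graph quotient_quotient_graph)

lemma induces_connected_fibre_contract_edge:
  assumes "simple_graph G" "{u, v} \<in> edges G" "f u = f v"
    and "induces_connected G {w \<in> verts G. f w = b}"
  shows "induces_connected (contract_edge u v G) {w \<in> verts (contract_edge u v G). f w = b}"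
proof -
  define g where "g = id(v := u)"
  have H: "contract_edge u v G = quotient_graph g G"
    unfolding g_def using assms(1,2) by (rule contract_edge_eq_quotient_graph)
  have "f (g w) = f w" for w
    by (simp add: g_def assms(3))
  then have "{w \<in> verts (contract_edge u v G). f w = b} = g ` {w \<in> verts G. f w = b}"
    by (auto simp: H verts_quotient_graph)
  with assms(4) show ?thesis
    by (simp add: H induces_connected_quotient_graph)
qed

theorem contracts_to_quotient_graph:
  assumes "simple_graph G" "\<And>b. induces_connected G {v \<in> verts G. f v = b}"
  shows "\<exists>K. contracts_to G K \<and> graph_iso (quotient_graph f G) K"
  using assms
proof (induction "card (verts G)" arbitrary: G rule: less_induct)
  case less
  show ?case
  proof (cases "inj_on f (verts G)")
    case True
    with less.prems(1) show ?thesis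
      using graph_iso_quotient_graph contracts_to.refl by blast
  next
    case False
    then obtain x y where "x \<in> verts G" "y \<in> verts G" "f y = f x" "x \<noteq> y"
      unfolding inj_on_def by metis
    with less.prems(2)[of "f x"] obtain u v where uv: "{u, v} \<in> edges G" "f u = f v"
      unfolding induces_connected_def adjacency_on_def by (fastforce elim: converse_rtranclE)
    then have "u \<noteq> v" "v \<in> verts G"
      using less.prems(1) by (auto simp: simple_graph_def)
    define H where "H = contract_edge u v G"
    have "verts H = verts G - {v}"
      by (simp add: H_def contract_edge_def)
    then have "card (verts H) < card (verts G)"
      using less.prems(1) \<open>v \<in> verts G\<close> by (metis card_Diff1_less simple_graph_def)
    moreover have "simple_graph H"
      using less.prems(1) uv(1) by (simp add: H_def contract_edge_eq_quotient_graph simple_quotient_graph)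
    moreover have "induces_connected H {w \<in> verts H. f w = b}" for b
      unfolding H_def using less.prems uv by (intro induces_connected_fibre_contract_edge)
    ultimately have "\<exists>K. contracts_to H K \<and> graph_iso (quotient_graph f H) K"
      by (rule less.hyps)
    moreover have "quotient_graph f H = quotient_graph f G"
      unfolding H_def using less.prems(1) uv by (rule quotient_graph_contract_edge)
    moreover have "contracts_to G H"
      unfolding H_def using contracts_to.refl uv(1) \<open>u \<noteq> v\<close> by (rule contracts_to.step)
    ultimately show ?thesis
      using contracts_to_trans by metis
  qed
qed

lemma is_minor_quotient_graph:
  assumes "subgraph S G" "\<And>b. induces_connected S {v \<in> verts S. f v = b}"
  shows "is_minor (quotient_graph f S) G"
  using assms contracts_to_quotient_graph unfolding is_minor_def subgraph_def by blast

lemma ex_index_of_disjoint_family_on: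
  assumes "disjoint_family_on B I"
  shows "\<exists>f. \<forall>x\<in>I. \<forall>v\<in>B x. f v = x"
proof (intro exI ballI)
  show "(THE x. x \<in> I \<and> v \<in> B x) = x" if "x \<in> I" "v \<in> B x" for x v
    using that assms by (intro the_equality) (auto simp: disjoint_family_on_def)
qed

theorem is_minorI_branch_sets:
  assumes simple_G: "simple_graph G" and simple_H: "simple_graph H"
    and subset: "\<And>x. x \<in> verts H \<Longrightarrow> B x \<subseteq> verts G"
    and nonempty: "\<And>x. x \<in> verts H \<Longrightarrow> B x \<noteq> {}"
    and disjoint: "disjoint_family_on B (verts H)"
    and connected: "\<And>x. x \<in> verts H \<Longrightarrow> induces_connected G (B x)"
    and adjacent: "\<And>x y. {x, y} \<in> edges H \<Longrightarrow> \<exists>u\<in>B x. \<exists>v\<in>B y. {u, v} \<in> edges G"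
  shows "is_minor H G"
proof -
  obtain f where f: "\<And>x v. x \<in> verts H \<Longrightarrow> v \<in> B x \<Longrightarrow> f v = x"
    using ex_index_of_disjoint_family_on[OF disjoint] by metis
  define S where "S = Graph (\<Union>x\<in>verts H. B x)
    {e \<in> edges G. e \<subseteq> (\<Union>x\<in>verts H. B x) \<and> (card (f ` e) = 2 \<longrightarrow> f ` e \<in> edges H)}"
  have "verts S \<subseteq> verts G"
    using subset by (auto simp: S_def)
  then have "subgraph S G"
    using simple_G finite_subset by (auto simp: S_def simple_graph_def subgraph_def)
  have fibre: "{v \<in> verts S. f v = x} = (if x \<in> verts H then B x else {})" for x
    using f by (auto simp: S_def)
  have "induces_connected S {v \<in> verts S. f v = x}" for x
  proof (cases "x \<in> verts H")
    case True
    have "f ` e \<subseteq> {x}" if "e \<subseteq> B x" for e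
      using f True that by auto
    then have "card (f ` e) \<noteq> 2" if "e \<subseteq> B x" for e
      using card_mono[of "{x}" "f ` e"] that by fastforce
    then show ?thesis
      unfolding fibre if_P[OF True] using True
      by (intro induces_connected_mono[OF connected[OF True]]) (fastforce simp: S_def)
  qed (simp add: fibre induces_connected_def)
  with \<open>subgraph S G\<close> have "is_minor (quotient_graph f S) G"
    by (rule is_minor_quotient_graph)
  moreover have "quotient_graph f S = H"
  proof (rule quotient_graph_eqI[OF simple_H])
    show "f ` verts S = verts H"
      using f nonempty by (force simp: S_def)
    fix x y assume xy: "{x, y} \<in> edges H"
    then have "x \<in> verts H" "y \<in> verts H"
      using simple_H by (auto simp: simple_graph_def)
    moreover from adjacent[OF xy] obtain u v where "u \<in> B x" "v \<in> B y" "{u, v} \<in> edges G"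
      by blast
    ultimately show "\<exists>u v. {u, v} \<in> edges S \<and> f u = x \<and> f v = y"
      using f xy by (intro exI[of _ u] exI[of _ v]) (auto simp: S_def)
  qed (simp add: S_def)
  ultimately show ?thesis by simp
qed

subsection \<open>Degrees and crossings\<close>

definition neighbours :: "'a ugraph \<Rightarrow> 'a \<Rightarrow> 'a set" where
  "neighbours G v = {w. {v, w} \<in> edges G}"

lemma neighbours_subset_verts: "simple_graph G \<Longrightarrow> neighbours G v \<subseteq> verts G"
  by (auto simp: neighbours_def simple_graph_def)

lemma finite_neighbours: "simple_graph G \<Longrightarrow> finite (neighbours G v)"
  using neighbours_subset_verts finite_subset by (fastforce simp: simple_graph_def)

lemma vertex_degree_eq_card_neighbours:
  assumes "simple_graph G"
  shows "vertex_degree G v = card (neighbours G v)"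
proof -
  have "{e \<in> edges G. v \<in> e} = (\<lambda>w. {v, w}) ` neighbours G v"
  proof (intro equalityI subsetI)
    fix e assume "e \<in> {e \<in> edges G. v \<in> e}"
    moreover from this obtain x y where "e = {x, y}"
      using assms by (auto simp: simple_graph_def card_2_iff)
    ultimately show "e \<in> (\<lambda>w. {v, w}) ` neighbours G v"
      by (auto simp: neighbours_def insert_commute)
  qed (auto simp: neighbours_def)
  moreover have "inj_on (\<lambda>w. {v, w}) (neighbours G v)"
    by (auto simp: inj_on_def doubleton_eq_iff)
  ultimately show ?thesis
    by (simp add: vertex_degree_def card_image)
qed

lemma vertex_degree_le_card:
  assumes "simple_graph G" "finite A" "neighbours G v \<subseteq> A"
  shows "vertex_degree G v \<le> card A"
  using assms by (simp add: vertex_degree_eq_card_neighbours card_mono)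

text \<open>The point \<open>1 / (1 - \<i> * s)\<close>: inversion maps a line to a circle through \<open>0\<close>.\<close>

definition circle_point :: "real \<Rightarrow> complex" where
  "circle_point s = Complex (1 / (1 + s\<^sup>2)) (s / (1 + s\<^sup>2))"

lemma circle_point_in_sphere: "circle_point s \<in> sphere (1/2) (1/2)"
proof -
  have pos: "1 + s\<^sup>2 > 0" by (simp add: add_pos_nonneg)
  have "(cmod (1/2 - circle_point s))\<^sup>2 = (1/2 - 1 / (1 + s\<^sup>2))\<^sup>2 + (s / (1 + s\<^sup>2))\<^sup>2"
    by (simp add: cmod_power2 circle_point_def)
  also have "\<dots> = (1/2)\<^sup>2"
    using pos by (simp add: divide_simps) algebra
  finally have "cmod (1/2 - circle_point s) = 1/2"
    by (rule power2_eq_imp_eq) simp_all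
  then show ?thesis by (simp add: dist_norm)
qed

lemma inj_circle_point: "inj circle_point"
proof (rule inj_on_inverseI)
  show "Im (circle_point s) / Re (circle_point s) = s" for s
    by (simp add: circle_point_def add_nonneg_eq_0_iff)
qed

lemma circular_drawing_circle_point:
  assumes "inj_on h (verts G)"
  shows "circular_drawing G (circle_point \<circ> h)"
proof -
  have "inj_on (circle_point \<circ> h) (verts G)"
    using assms inj_circle_point by (intro comp_inj_on) (auto intro: inj_on_subset)
  moreover have "(circle_point \<circ> h) ` verts G \<subseteq> sphere (1/2) (1/2)"
    using circle_point_in_sphere by auto
  moreover have "(1/2 :: real) > 0" by simp
  ultimately show ?thesis
    unfolding circular_drawing_def by blast
qed

text \<open>The zeros of \<open>chord_side u v\<close> form the line through the points with parameters \<open>u\<close> and \<open>v\<close>.\<close>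

definition chord_side :: "real \<Rightarrow> real \<Rightarrow> complex \<Rightarrow> real" where
  "chord_side u v z = 1 - (u + v) * Im z + (u * v - 1) * Re z"

lemma chord_side_circle_point:
  "chord_side u v (circle_point s) = (s - u) * (s - v) / (1 + s\<^sup>2)"
proof -
  define N where "N = 1 + s\<^sup>2"
  have "N > 0" by (simp add: N_def add_pos_nonneg)
  then have "chord_side u v (circle_point s) = (N - (u + v) * s + (u * v - 1)) / N"
    by (simp add: chord_side_def circle_point_def diff_divide_distrib add_divide_distrib
        flip: N_def)
  also have "N - (u + v) * s + (u * v - 1) = (s - u) * (s - v)"
    by (simp add: N_def algebra_simps power2_eq_square)
  finally show ?thesis by (simp add: N_def)
qed

lemma chord_side_affine:
  "chord_side u v ((1 - c) *\<^sub>R p + c *\<^sub>R q) = (1 - c) * chord_side u v p + c * chord_side u v q"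
  by (simp add: chord_side_def algebra_simps)

lemma chord_side_closed_segment:
  "z \<in> closed_segment (circle_point u) (circle_point v) \<Longrightarrow> chord_side u v z = 0"
  by (auto simp: in_segment chord_side_affine chord_side_circle_point)

lemma chord_side_circle_point_pos:
  assumes "u < v" "s \<notin> {u..v}"
  shows "chord_side u v (circle_point s) > 0"
proof -
  have "(s - u) * (s - v) > 0"
    using assms by (cases "s < u") (auto intro: mult_pos_pos mult_neg_neg)
  then show ?thesis
    by (simp add: chord_side_circle_point add_pos_nonneg)
qed

lemma chords_cross_interleave:
  assumes "u < v" and z_uv: "z \<in> closed_segment (circle_point u) (circle_point v)"
    and z_xy: "z \<in> open_segment (circle_point x) (circle_point y)" and "{x, y} \<noteq> {u, v}"
  shows "x \<in> {u<..<v} \<or> y \<in> {u<..<v}"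
proof (rule ccontr)
  let ?g = "\<lambda>s. chord_side u v (circle_point s)"
  assume outside: "\<not> ?thesis"
  obtain c where c: "0 < c" "c < 1" "z = (1 - c) *\<^sub>R circle_point x + c *\<^sub>R circle_point y"
    and "x \<noteq> y"
    using z_xy by (auto simp: in_segment)
  have sum0: "(1 - c) * ?g x + c * ?g y = 0"
    using chord_side_closed_segment[OF z_uv] by (simp add: c(3) chord_side_affine)
  have side: "s \<in> {u, v} \<or> ?g s > 0" and nonneg: "?g s \<ge> 0" if "s \<notin> {u<..<v}" for s
  proof -
    have "s \<in> {u, v} \<or> s \<notin> {u..v}"
      using that by auto
    then show "s \<in> {u, v} \<or> ?g s > 0"
      using chord_side_circle_point_pos[OF \<open>u < v\<close>] by blast
    then show "?g s \<ge> 0"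
      by (auto simp: chord_side_circle_point)
  qed
  have "(1 - c) * ?g x \<ge> 0" "c * ?g y \<ge> 0"
    using outside nonneg c(1,2) by simp_all
  with sum0 have "(1 - c) * ?g x = 0" "c * ?g y = 0" by linarith+
  with c(1,2) have "?g x = 0" "?g y = 0" by simp_all
  then have "x \<in> {u, v}" "y \<in> {u, v}"
    using side outside by fastforce+
  with \<open>x \<noteq> y\<close> \<open>{x, y} \<noteq> {u, v}\<close> show False by auto
qed

lemma edges_cross_interleave:
  fixes h :: "'a::linorder \<Rightarrow> real"
  assumes "strict_mono h" "edges_cross (circle_point \<circ> h) {u, v} f" "u < v"
  obtains w where "w \<in> f" "u < w" "w < v"
proof -
  let ?D = "circle_point \<circ> h"
  obtain u' v' x y z where uv: "{u, v} = {u', v'}" and f: "f = {x, y}" "{u, v} \<noteq> f"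
    and z_uv: "z \<in> closed_segment (?D u') (?D v')"
    and z_xy: "z \<in> closed_segment (?D x) (?D y)" "z \<notin> {?D u', ?D v', ?D x, ?D y}"
    using assms(2) unfolding edges_cross_def by metis
  have "z \<in> closed_segment (?D u) (?D v)"
    using uv z_uv by (auto simp: doubleton_eq_iff closed_segment_commute)
  moreover have "z \<in> open_segment (?D x) (?D y)"
    using z_xy by (simp add: open_segment_def)
  moreover have "{h x, h y} \<noteq> {h u, h v}"
    using f strict_mono_eq[OF assms(1)] by (auto simp: doubleton_eq_iff)
  moreover have "h u < h v"
    using assms(1,3) by (simp add: strict_mono_less)
  ultimately have "h x \<in> {h u<..<h v} \<or> h y \<in> {h u<..<h v}"
    by (intro chords_cross_interleave[of "h u" "h v" z]) simp_all
  then show thesis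
    using that f(1) assms(1) by (auto simp: strict_mono_less)
qed

lemma edges_cross_sym:
  assumes "edges_cross D e f"
  shows "edges_cross D f e"
proof -
  obtain u v x y z where "f \<noteq> e" "e = {u, v}" "f = {x, y}" "z \<in> closed_segment (D u) (D v)"
    "z \<in> closed_segment (D x) (D y)" and "z \<notin> {D u, D v, D x, D y}"
    using assms unfolding edges_cross_def by metis
  moreover from this have "z \<notin> {D x, D y, D u, D v}" by simp
  ultimately show ?thesis
    unfolding edges_cross_def by blast
qed

lemma neighbours_crossing_graph:
  "f \<in> neighbours (crossing_graph G D) e \<Longrightarrow> edges_cross D e f"
  by (auto simp: neighbours_def crossing_graph_def doubleton_eq_iff intro: edges_cross_sym)

lemma neighbours_subgraph:
  "subgraph H G \<Longrightarrow> neighbours H v \<subseteq> verts H \<inter> neighbours G v"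
  using neighbours_subset_verts by (fastforce simp: subgraph_def neighbours_def)

lemma degenerate_crossing_graphI:
  assumes "\<And>F. F \<subseteq> edges G \<Longrightarrow> finite F \<Longrightarrow> F \<noteq> {} \<Longrightarrow> \<exists>e\<in>F. card {f \<in> F. edges_cross D e f} \<le> d"
  shows "degenerate d (crossing_graph G D)"
  unfolding degenerate_def
proof (intro allI impI, elim conjE)
  fix H assume H: "subgraph H (crossing_graph G D)" "verts H \<noteq> {}"
  then have "simple_graph H" "finite (verts H)" "verts H \<subseteq> edges G"
    by (simp_all add: subgraph_def simple_graph_def crossing_graph_def)
  with assms H(2) obtain e where e: "e \<in> verts H" "card {f \<in> verts H. edges_cross D e f} \<le> d"
    by blast
  have "neighbours H e \<subseteq> {f \<in> verts H. edges_cross D e f}"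
    using neighbours_subgraph[OF H(1)] neighbours_crossing_graph by blast
  then have "vertex_degree H e \<le> card {f \<in> verts H. edges_cross D e f}"
    using \<open>simple_graph H\<close> \<open>finite (verts H)\<close> by (intro vertex_degree_le_card) simp_all
  with e(2) have "vertex_degree H e \<le> d" by simp
  with e(1) show "\<exists>e\<in>verts H. vertex_degree H e \<le> d" by blast
qed

subsection \<open>Dyadic graphs\<close>

definition dyadic_step :: "nat \<Rightarrow> nat" where
  "dyadic_step n = 2 ^ Suc (multiplicity 2 n)"

definition dyadic_edge :: "nat \<Rightarrow> nat set" where
  "dyadic_edge n = {n, n + dyadic_step n}"

lemma dyadic_step_ge_2: "dyadic_step n \<ge> 2"
  by (simp add: dyadic_step_def)

lemma dyadic_step_odd: "odd n \<Longrightarrow> dyadic_step n = 2"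
  by (simp add: dyadic_step_def not_dvd_imp_multiplicity_0)

lemma multiplicity_add_dyadic_step:
  assumes "0 < n"
  shows "multiplicity 2 (n + dyadic_step n) = multiplicity 2 n"
  using assms
  by (intro multiplicity_sum_lt)
    (simp_all add: dyadic_step_def multiplicity_same_power del: power_Suc)

lemma multiplicity_diff_dyadic_step:
  assumes "dyadic_step n < n"
  shows "multiplicity 2 (n - dyadic_step n) = multiplicity 2 n"
proof (rule multiplicity_eqI)
  show "2 ^ multiplicity 2 n dvd n - dyadic_step n"
    by (intro dvd_diff_nat) (simp_all add: multiplicity_dvd dyadic_step_def)
  have "\<not> dyadic_step n dvd n"
    using assms unfolding dyadic_step_def by (subst power_dvd_iff_le_multiplicity) auto
  then show "\<not> 2 ^ Suc (multiplicity 2 n) dvd n - dyadic_step n"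
    using assms unfolding dyadic_step_def[symmetric] by (meson dvd_diffD dvd_refl less_imp_le)
qed

lemma dyadic_edge_diff_dyadic_step:
  assumes "dyadic_step n < n"
  shows "dyadic_edge (n - dyadic_step n) = {n - dyadic_step n, n}"
  using assms multiplicity_diff_dyadic_step[OF assms]
  by (simp add: dyadic_edge_def dyadic_step_def del: power_Suc)

lemma multiplicity_dyadic_edge:
  "0 < m \<Longrightarrow> n \<in> dyadic_edge m \<Longrightarrow> multiplicity 2 n = multiplicity 2 m"
  using multiplicity_add_dyadic_step by (auto simp: dyadic_edge_def)

definition dyadic_edges_at :: "nat \<Rightarrow> nat set set" where
  "dyadic_edges_at n = {{n, n + dyadic_step n}, {n, n - dyadic_step n}}"

lemma finite_dyadic_edges_at: "finite (dyadic_edges_at n)"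
  by (simp add: dyadic_edges_at_def)

lemma card_dyadic_edges_at_le: "card (dyadic_edges_at n) \<le> 2"
  by (simp add: dyadic_edges_at_def card_insert_if)

lemma dyadic_edge_incident:
  assumes "0 < m" "n \<in> dyadic_edge m"
  shows "dyadic_edge m \<in> dyadic_edges_at n"
proof -
  have "dyadic_step n = dyadic_step m"
    using multiplicity_dyadic_edge[OF assms] by (simp add: dyadic_step_def)
  with assms(2) show ?thesis
    by (auto simp: dyadic_edge_def dyadic_edges_at_def)
qed

lemma multiple_between:
  fixes a b d :: nat
  assumes "d dvd a" "d dvd b" "a < b" "b < a + 2 * d"
  shows "b = a + d"
proof -
  obtain p q where "a = d * p" "b = d * q"
    using assms(1,2) by (auto elim!: dvdE)
  moreover from this have "d * p < d * q" "d * q < d * (p + 2)"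
    using assms(3,4) by (simp_all add: algebra_simps)
  then have "p < q" "q < p + 2" by (simp_all only: mult_less_cancel1)
  then have "q = p + 1" by simp
  ultimately show ?thesis by simp
qed

lemma dyadic_edge_midpoint:
  assumes "n < w" "w < n + dyadic_step n" "multiplicity 2 n \<le> multiplicity 2 w"
  shows "w = n + 2 ^ multiplicity 2 n"
  using assms
  by (intro multiple_between) (simp_all add: multiplicity_dvd multiplicity_dvd' dyadic_step_def)

lemma dyadic_step_less:
  assumes "0 < n" "n \<noteq> 2 ^ multiplicity 2 n"
  shows "dyadic_step n < n"
proof (rule ccontr)
  assume "\<not> dyadic_step n < n"
  moreover have "n \<noteq> dyadic_step n"
  proof
    assume "n = dyadic_step n"
    then have "multiplicity 2 n = multiplicity 2 (dyadic_step n)" by simp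
    then show False by (simp add: dyadic_step_def multiplicity_same_power del: power_Suc)
  qed
  ultimately have "n = 0 + 2 ^ multiplicity 2 n"
    using assms(1) by (intro multiple_between) (simp_all add: multiplicity_dvd dyadic_step_def)
  with assms(2) show False by simp
qed

text \<open>As \<open>multiplicity 2 0 = 0\<close>, there is a spurious \<open>dyadic_edge 0\<close>; it is excluded together with
  the vertex \<open>0\<close>.\<close>

definition dyadic_graph :: "nat \<Rightarrow> nat set \<Rightarrow> nat ugraph" where
  "dyadic_graph N U = Graph {0<..<N}
     {e \<in> range dyadic_edge \<union> (\<lambda>n. {n, Suc n}) ` U. e \<subseteq> {0<..<N}}"

lemma verts_dyadic_graph [simp]: "verts (dyadic_graph N U) = {0<..<N}"
  by (simp add: dyadic_graph_def)

lemma edges_dyadic_graph_cases: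
  assumes "e \<in> edges (dyadic_graph N U)"
  obtains (dyadic) n where "0 < n" "e = dyadic_edge n"
    | (unit) n where "n \<in> U" "e = {n, Suc n}"
  using assms by (auto simp: dyadic_graph_def dyadic_edge_def)

lemma dyadic_edge_in_dyadic_graph:
  "0 < n \<Longrightarrow> n + dyadic_step n < N \<Longrightarrow> {n, n + dyadic_step n} \<in> edges (dyadic_graph N U)"
  by (auto simp: dyadic_graph_def dyadic_edge_def)

lemma dyadic_edge_below_in_dyadic_graph:
  assumes "dyadic_step n < n" "n < N"
  shows "{n - dyadic_step n, n} \<in> edges (dyadic_graph N U)"
proof -
  have "{n - dyadic_step n, n} \<in> range dyadic_edge"
    using dyadic_edge_diff_dyadic_step[OF assms(1)] by (metis rangeI)
  with assms show ?thesis
    by (simp add: dyadic_graph_def)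
qed

lemma unit_edge_in_dyadic_graph:
  "n \<in> U \<Longrightarrow> 0 < n \<Longrightarrow> Suc n < N \<Longrightarrow> {n, Suc n} \<in> edges (dyadic_graph N U)"
  by (auto simp: dyadic_graph_def)

lemma simple_dyadic_graph: "simple_graph (dyadic_graph N U)"
  unfolding simple_graph_def
proof (intro conjI ballI)
  fix e assume e: "e \<in> edges (dyadic_graph N U)"
  then show "e \<subseteq> verts (dyadic_graph N U)"
    by (simp add: dyadic_graph_def)
  from e show "card e = 2"
    by (cases rule: edges_dyadic_graph_cases) (simp_all add: dyadic_edge_def dyadic_step_def)
qed simp

lemma not_edges_cross_unit_edge: "\<not> edges_cross (circle_point \<circ> real) {n, Suc n} f"
  by (auto elim!: edges_cross_interleave[rotated] simp: strict_mono_def)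

lemma dyadic_edge_through_midpoint:
  assumes "0 < m" "multiplicity 2 n \<le> multiplicity 2 m"
    and "edges_cross (circle_point \<circ> real) (dyadic_edge n) (dyadic_edge m)"
  shows "dyadic_edge m \<in> dyadic_edges_at (n + 2 ^ multiplicity 2 n)"
proof -
  have "n < n + dyadic_step n"
    using dyadic_step_ge_2[of n] by simp
  then obtain w where w: "w \<in> dyadic_edge m" "n < w" "w < n + dyadic_step n"
    using edges_cross_interleave[of real n "n + dyadic_step n" "dyadic_edge m"] assms(3)
    by (auto simp: strict_mono_def dyadic_edge_def[of n])
  moreover have "multiplicity 2 n \<le> multiplicity 2 w"
    using multiplicity_dyadic_edge[OF assms(1) w(1)] assms(2) by simp
  ultimately have "w = n + 2 ^ multiplicity 2 n"
    by (intro dyadic_edge_midpoint)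
  with w(1) assms(1) show ?thesis
    using dyadic_edge_incident by blast
qed

theorem degenerate_crossing_dyadic_graph:
  "degenerate 2 (crossing_graph (dyadic_graph N U) (circle_point \<circ> real))"
proof (rule degenerate_crossing_graphI)
  let ?cross = "edges_cross (circle_point \<circ> real)"
  fix F assume F: "F \<subseteq> edges (dyadic_graph N U)" "F \<noteq> {}"
  show "\<exists>e\<in>F. card {f \<in> F. ?cross e f} \<le> 2"
  proof (cases "\<exists>n. {n, Suc n} \<in> F")
    case True
    then obtain n where "{n, Suc n} \<in> F" ..
    then show ?thesis
      by (intro bexI[of _ "{n, Suc n}"]) (simp_all add: not_edges_cross_unit_edge)
  next
    case False
    then have dyadic: "\<exists>n>0. f = dyadic_edge n" if "f \<in> F" for f
      using F(1) that by (blast elim: edges_dyadic_graph_cases)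
    with F(2) obtain l where "0 < l \<and> dyadic_edge l \<in> F"
      by blast
    from ex_has_least_nat[of "\<lambda>n. 0 < n \<and> dyadic_edge n \<in> F", OF this, of "multiplicity 2"]
    obtain n where n: "dyadic_edge n \<in> F"
      and minimal: "\<And>m. 0 < m \<Longrightarrow> dyadic_edge m \<in> F \<Longrightarrow> multiplicity 2 n \<le> multiplicity 2 m"
      by blast
    let ?A = "dyadic_edges_at (n + 2 ^ multiplicity 2 n)"
    have "f \<in> ?A" if f: "f \<in> F" "?cross (dyadic_edge n) f" for f
    proof -
      obtain m where "0 < m" "f = dyadic_edge m"
        using dyadic f(1) by blast
      with f minimal show ?thesis
        using dyadic_edge_through_midpoint by blast
    qed
    then have "card {f \<in> F. ?cross (dyadic_edge n) f} \<le> card ?A"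
      by (intro card_mono finite_dyadic_edges_at) auto
    also have "\<dots> \<le> 2"
      by (rule card_dyadic_edges_at_le)
    finally show ?thesis using n by blast
  qed
qed

lemma vertex_degree_dyadic_graph_le:
  assumes no_consecutive: "\<And>n. n \<in> U \<Longrightarrow> Suc n \<notin> U"
  shows "vertex_degree (dyadic_graph N U) n \<le> 3"
proof -
  let ?u = "if n \<in> U then Suc n else n - 1"
  let ?A = "{n - dyadic_step n, n + dyadic_step n, ?u}"
  have "w \<in> ?A" if "{n, w} \<in> edges (dyadic_graph N U)" for w
    using that
  proof (cases rule: edges_dyadic_graph_cases)
    case (dyadic m)
    then have "{n, w} \<in> dyadic_edges_at n"
      using dyadic_edge_incident[of m n] by (metis insertI1)
    then show ?thesis by (auto simp: dyadic_edges_at_def doubleton_eq_iff)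
  next
    case (unit m)
    then show ?thesis
      using no_consecutive[of m] by (auto simp: doubleton_eq_iff)
  qed
  then have "neighbours (dyadic_graph N U) n \<subseteq> ?A"
    unfolding neighbours_def by blast
  then have "vertex_degree (dyadic_graph N U) n \<le> card ?A"
    by (intro vertex_degree_le_card simple_dyadic_graph) simp_all
  also have "card ?A \<le> 3"
    by (simp add: card_insert_if)
  finally show ?thesis .
qed

lemma vertex_degree_dyadic_graph_ge:
  assumes "n \<in> U" "dyadic_step n < n" "n + dyadic_step n < N"
  shows "vertex_degree (dyadic_graph N U) n \<ge> 3"
proof -
  let ?A = "{n - dyadic_step n, n + dyadic_step n, Suc n}"
  have "?A \<subseteq> neighbours (dyadic_graph N U) n"
    using assms dyadic_step_ge_2[of n] dyadic_edge_in_dyadic_graph[of n N U]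
      dyadic_edge_below_in_dyadic_graph[of n N U] unit_edge_in_dyadic_graph[of n U N]
    by (simp add: neighbours_def insert_commute)
  then have "card ?A \<le> vertex_degree (dyadic_graph N U) n"
    by (simp add: vertex_degree_eq_card_neighbours simple_dyadic_graph finite_neighbours card_mono)
  moreover have "card ?A = 3"
    using assms(2) dyadic_step_ge_2[of n] by (auto simp: card_insert_if)
  ultimately show ?thesis by simp
qed

lemma max_degree_dyadic_graph:
  assumes "\<And>n. n \<in> U \<Longrightarrow> Suc n \<notin> U"
    and attached: "n \<in> U" "dyadic_step n < n" "n + dyadic_step n < N"
  shows "max_degree (dyadic_graph N U) = 3"
proof -
  let ?deg = "vertex_degree (dyadic_graph N U)"
  have degree_le: "?deg m \<le> 3" for m
    using assms(1) by (rule vertex_degree_dyadic_graph_le)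
  moreover have "?deg n = 3"
    using degree_le vertex_degree_dyadic_graph_ge[OF attached] by (rule antisym)
  then have "3 \<in> ?deg ` verts (dyadic_graph N U)"
    using attached by (intro image_eqI[of _ _ n]) auto
  ultimately show ?thesis
    unfolding max_degree_def by (intro Max_eqI) auto
qed

subsection \<open>Linking the spines\<close>

text \<open>The link between spines \<open>i < j\<close> lies in the block of length \<open>2\<^bsup>T + 2\<^esup>\<close> with index \<open>T * j + i\<close>.
  It starts on spine \<open>j\<close> and ends on spine \<open>i\<close>, but its interior belongs to the branch set of \<open>j\<close>.\<close>

definition link_start :: "nat \<Rightarrow> nat \<Rightarrow> nat \<Rightarrow> nat" where
  "link_start T i j = (T * j + i) * 2 ^ (T + 2) + 2 ^ (j + 2)"

definition link_end :: "nat \<Rightarrow> nat \<Rightarrow> nat \<Rightarrow> nat" where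
  "link_end T i j = link_start T i j + 2 ^ (i + 2)"

definition vertex_bound :: "nat \<Rightarrow> nat" where
  "vertex_bound T = T * T * 2 ^ (T + 2)"

definition link_attachments :: "nat \<Rightarrow> nat set" where
  "link_attachments T =
     {link_start T i j | i j. i < j \<and> j < T} \<union> {link_end T i j - 1 | i j. i < j \<and> j < T}"

definition linked_spine_graph :: "nat \<Rightarrow> nat ugraph" where
  "linked_spine_graph T = dyadic_graph (vertex_bound T) (link_attachments T)"

definition spine :: "nat \<Rightarrow> nat \<Rightarrow> nat set" where
  "spine T k = {n. 0 < n \<and> n < vertex_bound T \<and> multiplicity 2 n = k + 2}"

definition link_interior :: "nat \<Rightarrow> nat \<Rightarrow> nat \<Rightarrow> nat set" where
  "link_interior T i j = {n. odd n \<and> link_start T i j < n \<and> n < link_end T i j}"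

definition branch_set :: "nat \<Rightarrow> nat \<Rightarrow> nat set" where
  "branch_set T k = spine T k \<union> (\<Union>i<k. link_interior T i k)"

lemma link_start_pos: "0 < link_start T i j"
  by (simp add: link_start_def)

context
  fixes T i j :: nat
  assumes ij: "i < j" "j < T"
begin

lemma link_end_less_block_end: "link_end T i j < (T * j + i + 1) * 2 ^ (T + 2)"
proof -
  have "(2::nat) ^ (i + 2) < 2 ^ (j + 2)"
    using ij by (intro power_strict_increasing) auto
  moreover have "2 ^ (j + 2) + 2 ^ (j + 2) = (2::nat) ^ (j + 3)"
    by (simp add: power_add)
  moreover have "(2::nat) ^ (j + 3) \<le> 2 ^ (T + 2)"
    using ij by (intro power_increasing) auto
  ultimately have "2 ^ (j + 2) + 2 ^ (i + 2) < (2::nat) ^ (T + 2)"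
    by linarith
  then show ?thesis
    by (simp add: link_end_def link_start_def)
qed

lemma div_link:
  assumes "link_start T i j \<le> n" "n \<le> link_end T i j"
  shows "n div 2 ^ (T + 2) = T * j + i"
proof (rule div_nat_eqI)
  show "2 ^ (T + 2) * (T * j + i) \<le> n"
    using assms(1) by (simp add: link_start_def mult.commute)
  show "n < 2 ^ (T + 2) * Suc (T * j + i)"
    using assms(2) link_end_less_block_end by (simp add: mult.commute)
qed

lemma link_end_less: "link_end T i j < vertex_bound T"
proof -
  have "T * j + i + 1 \<le> T * Suc j"
    using ij by simp
  also have "\<dots> \<le> T * T"
    using ij by (intro mult_le_mono2) simp
  finally have "(T * j + i + 1) * 2 ^ (T + 2) \<le> vertex_bound T"
    unfolding vertex_bound_def by (rule mult_le_mono1)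
  with link_end_less_block_end show ?thesis
    by (rule less_le_trans)
qed

lemma link_start_less_end: "Suc (link_start T i j) < link_end T i j"
proof -
  have "4 \<le> (2::nat) ^ (i + 2)"
    by simp
  then show ?thesis
    unfolding link_end_def by linarith
qed

lemma multiplicity_link_start: "multiplicity 2 (link_start T i j) = j + 2"
proof -
  have "2 ^ (T + 2) dvd (T * j + i) * 2 ^ (T + 2)" "(T * j + i) * 2 ^ (T + 2) \<noteq> 0"
    using ij by simp_all
  then have "T + 2 \<le> multiplicity 2 ((T * j + i) * 2 ^ (T + 2))"
    by (intro multiplicity_geI) simp_all
  then have "multiplicity 2 (2 ^ (j + 2) + (T * j + i) * 2 ^ (T + 2)) = j + 2"
    using ij by (subst multiplicity_sum_lt) (simp_all add: multiplicity_same_power del: power_Suc)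
  then show ?thesis
    by (simp add: link_start_def add.commute)
qed

lemma multiplicity_link_end: "multiplicity 2 (link_end T i j) = i + 2"
proof -
  have "multiplicity 2 (2 ^ (i + 2) + link_start T i j) = i + 2"
    using ij multiplicity_link_start
    by (subst multiplicity_sum_lt) (simp_all add: multiplicity_same_power link_start_pos del: power_Suc)
  then show ?thesis
    by (simp add: link_end_def add.commute)
qed

lemma four_dvd_link_start: "4 dvd link_start T i j"
  using multiplicity_dvd'[of 2 2 "link_start T i j"] by (simp add: multiplicity_link_start)

lemma four_dvd_link_end: "4 dvd link_end T i j"
  using multiplicity_dvd'[of 2 2 "link_end T i j"] by (simp add: multiplicity_link_end)

lemma link_start_in_spine: "link_start T i j \<in> spine T j"
  using link_start_pos link_end_less link_start_less_end
  by (simp add: spine_def multiplicity_link_start)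

lemma link_end_in_spine: "link_end T i j \<in> spine T i"
  using link_end_less link_start_less_end by (simp add: spine_def multiplicity_link_end)

lemma link_start_in_attachments: "link_start T i j \<in> link_attachments T"
  using ij by (auto simp: link_attachments_def)

lemma link_end_pred_in_attachments: "link_end T i j - 1 \<in> link_attachments T"
  using ij by (auto simp: link_attachments_def)

lemma link_start_edge: "{link_start T i j, Suc (link_start T i j)} \<in> edges (linked_spine_graph T)"
  unfolding linked_spine_graph_def
  using link_start_in_attachments link_start_pos link_end_less link_start_less_end
  by (intro unit_edge_in_dyadic_graph) simp_all

lemma link_end_edge: "{link_end T i j - 1, link_end T i j} \<in> edges (linked_spine_graph T)"
proof -
  have pred: "Suc (link_end T i j - 1) = link_end T i j" "0 < link_end T i j - 1"
    using link_start_less_end by simp_all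
  have "{link_end T i j - 1, Suc (link_end T i j - 1)} \<in> edges (linked_spine_graph T)"
    unfolding linked_spine_graph_def using link_end_pred_in_attachments pred link_end_less
    by (intro unit_edge_in_dyadic_graph) simp_all
  then show ?thesis unfolding pred .
qed

lemma link_interior_subset: "link_interior T i j \<subseteq> {0<..<vertex_bound T}"
  using link_end_less by (auto simp: link_interior_def)

lemma div_link_interior: "n \<in> link_interior T i j \<Longrightarrow> n div 2 ^ (T + 2) = T * j + i"
  using div_link[of n] by (simp add: link_interior_def)

lemma link_interior_descent:
  assumes "n \<in> link_interior T i j"
  obtains m where "m \<in> insert (link_start T i j) (link_interior T i j)" "m < n"
    "{m, n} \<in> edges (linked_spine_graph T)"
proof (cases "n = Suc (link_start T i j)")
  case True
  with link_start_edge that[of "link_start T i j"] show thesis by simp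
next
  case False
  have n: "odd n" "link_start T i j < n" "n < link_end T i j"
    using assms by (simp_all add: link_interior_def)
  moreover have "even (link_start T i j)"
    using four_dvd_link_start by presburger
  ultimately have beyond: "link_start T i j + 2 < n"
    using False by presburger
  then have "n - 2 \<in> link_interior T i j"
    using n by (auto simp: link_interior_def)
  moreover have "{n - dyadic_step n, n} \<in> edges (linked_spine_graph T)"
    unfolding linked_spine_graph_def using beyond n link_end_less
    by (intro dyadic_edge_below_in_dyadic_graph) (simp_all add: dyadic_step_odd)
  ultimately show thesis
    using that[of "n - 2"] n beyond by (simp add: dyadic_step_odd)
qed

end

lemma block_index_inject:
  fixes T i j i' j' :: nat
  assumes "i < j" "j < T" "i' < j'" "j' < T" "T * j + i = T * j' + i'"
  shows "i = i' \<and> j = j'"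
proof -
  have "(T * j + i) div T = j" "(T * j' + i') div T = j'"
    using assms(1-4) by simp_all
  with assms(5) show ?thesis by simp
qed

lemma link_start_neq_link_end:
  assumes "i < j" "j < T" "i' < j'" "j' < T"
  shows "link_start T i j \<noteq> link_end T i' j'"
proof
  assume eq: "link_start T i j = link_end T i' j'"
  then have "T * j + i = T * j' + i'"
    using div_link[OF assms(1,2), of "link_start T i j"]
      div_link[OF assms(3,4), of "link_start T i j"]
      link_start_less_end[OF assms(1,2)] link_start_less_end[OF assms(3,4)] by simp
  then have "i = i' \<and> j = j'"
    using assms by (intro block_index_inject)
  with eq link_start_less_end[OF assms(1,2)] show False by simp
qed

lemma link_attachments_cases:
  assumes "n \<in> link_attachments T"
  obtains (start) i j where "i < j" "j < T" "n = link_start T i j"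
    | (finish) i j where "i < j" "j < T" "Suc n = link_end T i j"
proof -
  from assms consider (start) i j where "i < j" "j < T" "n = link_start T i j"
    | (pred) i j where "i < j" "j < T" "n = link_end T i j - 1"
    unfolding link_attachments_def by blast
  then show thesis
  proof cases
    case (pred i j)
    then have "Suc n = link_end T i j"
      using link_start_less_end[of i j T] by simp
    with pred(1,2) show thesis by (rule finish)
  qed (rule that(1))
qed

lemma four_dvd_link_attachment:
  "n \<in> link_attachments T \<Longrightarrow> 4 dvd n \<or> 4 dvd Suc n"
  by (auto elim!: link_attachments_cases simp: four_dvd_link_start four_dvd_link_end)

lemma link_attachments_not_consecutive:
  assumes "n \<in> link_attachments T"
  shows "Suc n \<notin> link_attachments T"
proof
  assume "Suc n \<in> link_attachments T"
  from assms show False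
  proof (cases rule: link_attachments_cases)
    case (start i j)
    then have "4 dvd n" by (simp add: four_dvd_link_start)
    with four_dvd_link_attachment[OF \<open>Suc n \<in> link_attachments T\<close>] show False by presburger
  next
    case end_ij: (finish i j)
    from \<open>Suc n \<in> link_attachments T\<close> show False
    proof (cases rule: link_attachments_cases)
      case (start i' j')
      with end_ij show False
        using link_start_neq_link_end[of i' j' T i j] by simp
    next
      case (finish i' j')
      then have "4 dvd Suc n" "4 dvd Suc (Suc n)"
        using end_ij by (simp_all add: four_dvd_link_end)
      then show False by presburger
    qed
  qed
qed

lemma max_degree_linked_spine_graph:
  assumes "2 \<le> T"
  shows "max_degree (linked_spine_graph T) = 3"
  unfolding linked_spine_graph_def
proof (rule max_degree_dyadic_graph)
  let ?n = "link_start T 0 1"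
  have step: "dyadic_step ?n = 16"
    using assms by (simp add: dyadic_step_def multiplicity_link_start)
  have start_eq: "?n = T * 2 ^ (T + 2) + 8"
    by (simp add: link_start_def)
  have "(2::nat) ^ (T + 2) \<ge> 16"
    using power_increasing[of 4 "T + 2" "2::nat"] assms by simp
  with assms have "2 * 16 \<le> T * 2 ^ (T + 2)"
    by (intro mult_le_mono)
  moreover have "2 * (T * 2 ^ (T + 2)) \<le> T * (T * 2 ^ (T + 2))"
    using assms by (rule mult_le_mono1)
  ultimately have "?n > 16" "?n + 16 < vertex_bound T"
    unfolding vertex_bound_def start_eq mult.assoc by linarith+
  then show "dyadic_step ?n < ?n" "?n + dyadic_step ?n < vertex_bound T"
    unfolding step .
  show "?n \<in> link_attachments T"
    using assms by (intro link_start_in_attachments) simp_all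
qed (rule link_attachments_not_consecutive)

lemma power_in_spine:
  assumes "k < T"
  shows "2 ^ (k + 2) \<in> spine T k"
proof -
  have "(2::nat) ^ (k + 2) < 2 ^ (T + 2)"
    using assms by (intro power_strict_increasing) auto
  also have "\<dots> \<le> vertex_bound T"
    using assms by (simp add: vertex_bound_def)
  finally show ?thesis
    by (simp add: spine_def multiplicity_same_power del: power_Suc)
qed

lemma spine_descent:
  assumes "n \<in> spine T k" "n \<noteq> 2 ^ (k + 2)"
  obtains m where "m \<in> spine T k" "m < n" "{m, n} \<in> edges (linked_spine_graph T)"
proof
  have n: "0 < n" "n < vertex_bound T" "multiplicity 2 n = k + 2"
    using assms(1) by (simp_all add: spine_def)
  with assms(2) have less: "dyadic_step n < n"
    by (intro dyadic_step_less) simp_all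
  show "n - dyadic_step n \<in> spine T k"
    using n less multiplicity_diff_dyadic_step[OF less] by (simp add: spine_def)
  show "n - dyadic_step n < n"
    using n(1) dyadic_step_ge_2[of n] by simp
  show "{n - dyadic_step n, n} \<in> edges (linked_spine_graph T)"
    unfolding linked_spine_graph_def using less n(2) by (rule dyadic_edge_below_in_dyadic_graph)
qed

lemma induces_connected_branch_set:
  assumes "k < T"
  shows "induces_connected (linked_spine_graph T) (branch_set T k)"
proof (rule induces_connected_wellorderI)
  show "2 ^ (k + 2) \<in> branch_set T k"
    using power_in_spine[OF assms] by (simp add: branch_set_def)
  fix n assume "n \<in> branch_set T k" "n \<noteq> 2 ^ (k + 2)"
  then consider (spine) "n \<in> spine T k" | (link) i where "i < k" "n \<in> link_interior T i k"
    by (auto simp: branch_set_def)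
  then show "\<exists>m\<in>branch_set T k. m < n \<and> {m, n} \<in> edges (linked_spine_graph T)"
  proof cases
    case spine
    with \<open>n \<noteq> 2 ^ (k + 2)\<close> show ?thesis
      unfolding branch_set_def by (meson UnI1 spine_descent)
  next
    case link
    then obtain m where "m \<in> insert (link_start T i k) (link_interior T i k)" "m < n"
      "{m, n} \<in> edges (linked_spine_graph T)"
      using link_interior_descent[OF \<open>i < k\<close> assms] by blast
    moreover have "insert (link_start T i k) (link_interior T i k) \<subseteq> branch_set T k"
      using \<open>i < k\<close> link_start_in_spine[OF \<open>i < k\<close> assms] by (auto simp: branch_set_def)
    ultimately show ?thesis by blast
  qed
qed

lemma disjoint_branch_sets: "disjoint_family_on (branch_set T) {..<T}"
  unfolding disjoint_family_on_def
proof (intro ballI impI)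
  fix k l assume kl: "k \<in> {..<T}" "l \<in> {..<T}" "k \<noteq> l"
  have "spine T k \<inter> spine T l = {}"
    using \<open>k \<noteq> l\<close> by (auto simp: spine_def)
  moreover have "spine T a \<inter> link_interior T i b = {}" for a b i
    by (auto simp: spine_def link_interior_def not_dvd_imp_multiplicity_0)
  moreover have "link_interior T i k \<inter> link_interior T i' l = {}" if "i < k" "i' < l" for i i'
  proof (rule equals0I)
    fix n assume "n \<in> link_interior T i k \<inter> link_interior T i' l"
    then have "T * k + i = T * l + i'"
      using div_link_interior[of i k T n] div_link_interior[of i' l T n] that kl by simp
    with kl that show False
      using block_index_inject[of i k T i' l] by simp
  qed
  ultimately show "branch_set T k \<inter> branch_set T l = {}"
    unfolding branch_set_def by blast
qed

lemma branch_sets_adjacent: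
  assumes "i < j" "j < T"
  shows "\<exists>u\<in>branch_set T i. \<exists>v\<in>branch_set T j. {u, v} \<in> edges (linked_spine_graph T)"
proof (intro bexI)
  show "{link_end T i j, link_end T i j - 1} \<in> edges (linked_spine_graph T)"
    using link_end_edge[OF assms] by (simp add: insert_commute)
  show "link_end T i j \<in> branch_set T i"
    using link_end_in_spine[OF assms] by (simp add: branch_set_def)
  have "even (link_end T i j)"
    using four_dvd_link_end[OF assms] by presburger
  then have "link_end T i j - 1 \<in> link_interior T i j"
    using link_start_less_end[OF assms] by (simp add: link_interior_def)
  with assms(1) show "link_end T i j - 1 \<in> branch_set T j"
    by (auto simp: branch_set_def)
qed

lemma simple_complete_graph: "simple_graph (complete_graph t)"
  by (simp add: simple_graph_def complete_graph_def)

theorem complete_graph_minor_linked_spine_graph: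
  assumes "t \<le> T"
  shows "is_minor (complete_graph t) (linked_spine_graph T)"
proof (rule is_minorI_branch_sets)
  show "simple_graph (linked_spine_graph T)"
    by (simp add: linked_spine_graph_def simple_dyadic_graph)
  show "simple_graph (complete_graph t)"
    by (rule simple_complete_graph)
  show "disjoint_family_on (branch_set T) (verts (complete_graph t))"
    using assms
    by (intro disjoint_family_on_mono[OF _ disjoint_branch_sets]) (simp add: complete_graph_def)
  show "\<exists>u\<in>branch_set T i. \<exists>v\<in>branch_set T j. {u, v} \<in> edges (linked_spine_graph T)"
    if "{i, j} \<in> edges (complete_graph t)" for i j
  proof -
    have "i < T" "j < T" "i \<noteq> j"
      using that assms by (auto simp: complete_graph_def)
    then show ?thesis
      using branch_sets_adjacent by (metis insert_commute linorder_neqE_nat)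
  qed
  fix k assume "k \<in> verts (complete_graph t)"
  then have "k < T"
    using assms by (simp add: complete_graph_def)
  then show "induces_connected (linked_spine_graph T) (branch_set T k)"
    by (rule induces_connected_branch_set)
  show "branch_set T k \<noteq> {}"
    using power_in_spine[OF \<open>k < T\<close>] by (auto simp: branch_set_def)
  show "branch_set T k \<subseteq> verts (linked_spine_graph T)"
    using link_interior_subset \<open>k < T\<close>
    by (fastforce simp: branch_set_def spine_def linked_spine_graph_def)
qed

theorem theorem19:
  "\<forall>t::nat. \<exists>(G :: nat ugraph) (D :: nat \<Rightarrow> complex).
     simple_graph G \<and> circular_drawing G D \<and>
     is_minor (complete_graph t) G \<and>
     max_degree G = 3 \<and>
     degenerate 2 (crossing_graph G D)"
proof (intro allI exI conjI)
  fix t :: nat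
  let ?G = "linked_spine_graph (t + 2)"
  show "simple_graph ?G"
    by (simp add: linked_spine_graph_def simple_dyadic_graph)
  show "circular_drawing ?G (circle_point \<circ> real)"
    by (rule circular_drawing_circle_point) simp
  show "is_minor (complete_graph t) ?G"
    by (rule complete_graph_minor_linked_spine_graph) simp
  show "max_degree ?G = 3"
    by (rule max_degree_linked_spine_graph) simp
  show "degenerate 2 (crossing_graph ?G (circle_point \<circ> real))"
    unfolding linked_spine_graph_def by (rule degenerate_crossing_dyadic_graph)
qed

end
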